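(* Let $G$ be a finite group acting on a finite nonempty set $X$, let $K$ be the classical Burnside kernel on $X$ and $Q$ the dual Burnside kernel on $G^*$. Let $\lambda_1$ be the largest nontrivial eigenvalue of $K$, equivalently of $Q$. For $g\in G^*$ and every integer $t\ge1$, $$\chi_g^2(Q,t)=\sum_{x\in X_g}\sum_{y\in X_g}\frac1{|X_g|^2}\left(\frac{K^{2t-1}(x,y)}{\pi_K(y)}-1\right).$$ Consequently, $$\chi_g^2(Q,t)\le\lambda_1\frac1{|X_g|}\sum_{x\in X_g}\chi_x^2(K,t-1)\le\lambda_1\max_{x\in X_g}\chi_x^2(K,t-1).$$
   Context: For $g\in G$ and $x\in X$ write $X_g:=\{x\in X: g\cdot x=x\}$, $G_x:=\{g\in G: g\cdot x=x\}$, and $G^*:=\{g\in G: X_g\neq\varnothing\}$. The classical Burnside kernel on $X$ is $$K(x,y)=\frac1{|G_x|}\sum_{g\in G_x\cap G_y}\frac1{|X_g|},$$ with stationary law $\pi_K(x)=|G_x|/(|G|\,|X/G|)$; the dual Burnside kernel on $G^*$ is $$Q(g,h)=\frac1{|X_g|}\sum_{x\in X_g\cap X_h}\frac1{|G_x|},$$ with stationary law $\pi_Q(g)=|X_g|/(|G|\,|X/G|)$. Both chains are irreducible and reversible. For such a kernel $P$, the largest nontrivial eigenvalue is $\lambda_1(P):=\max\{\lambda\in\mathrm{Spec}(P):\lambda\ne1\}$, with $\lambda_1(P):=0$ if $1$ is the only eigenvalue; one has $\lambda_1(K)=\lambda_1(Q)$. For a kernel $P$ on a finite set $S$ with positive stationary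 law $\pi$, and $s\in S$, $t\ge0$, $$\chi_s^2(P,t):=\sum_{u\in S}\frac{(P^t(s,u)-\pi(u))^2}{\pi(u)}.$$ *)

theory Defs
  imports Complex_Main "HOL-Algebra.Group_Action"
begin

text \<open>Kernels on a finite set \<open>S\<close> are functions \<open>P :: 's \<Rightarrow> 's \<Rightarrow> real\<close>; only the values on
  \<open>S \<times> S\<close> matter, and every sum and quantifier below is relativised to \<open>S\<close>.\<close>

primrec kernel_power :: "'s set \<Rightarrow> ('s \<Rightarrow> 's \<Rightarrow> real) \<Rightarrow> nat \<Rightarrow> 's \<Rightarrow> 's \<Rightarrow> real" where
  "kernel_power S P 0 = (\<lambda>s u. if s = u then 1 else 0)"
| "kernel_power S P (Suc t) = (\<lambda>s u. \<Sum>v\<in>S. P s v * kernel_power S P t v u)"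

text \<open>The eigenvalues of the matrix \<open>(P s u)\<close> with \<open>s, u \<in> S\<close>. For a reversible kernel it is no
  restriction to consider real eigenvalues and eigenfunctions only, see
  \<open>reversible_complex_eigenvalue\<close> below.\<close>

definition kernel_spectrum :: "'s set \<Rightarrow> ('s \<Rightarrow> 's \<Rightarrow> real) \<Rightarrow> real set" where
  "kernel_spectrum S P =
     {l. \<exists>f. (\<exists>s\<in>S. f s \<noteq> 0) \<and> (\<forall>s\<in>S. (\<Sum>u\<in>S. P s u * f u) = l * f s)}"

definition lambda1 :: "'s set \<Rightarrow> ('s \<Rightarrow> 's \<Rightarrow> real) \<Rightarrow> real" where
  "lambda1 S P = (if kernel_spectrum S P \<subseteq> {1} then 0
                  else Max {l \<in> kernel_spectrum S P. l \<noteq> 1})"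

definition chi_sq :: "'s set \<Rightarrow> ('s \<Rightarrow> 's \<Rightarrow> real) \<Rightarrow> ('s \<Rightarrow> real) \<Rightarrow> 's \<Rightarrow> nat \<Rightarrow> real" where
  "chi_sq S P \<pi> s t = (\<Sum>u\<in>S. (kernel_power S P t s u - \<pi> u)\<^sup>2 / \<pi> u)"

lemma reversible_complex_eigenvalue:
  fixes P :: "'s \<Rightarrow> 's \<Rightarrow> real" and \<pi> :: "'s \<Rightarrow> real" and l :: complex and f :: "'s \<Rightarrow> complex"
  assumes fin: "finite S"
    and pos: "\<And>s. s \<in> S \<Longrightarrow> \<pi> s > 0"
    and rev: "\<And>s u. s \<in> S \<Longrightarrow> u \<in> S \<Longrightarrow> \<pi> s * P s u = \<pi> u * P u s"
    and nz: "\<exists>s\<in>S. f s \<noteq> 0"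
    and ev: "\<And>s. s \<in> S \<Longrightarrow> (\<Sum>u\<in>S. of_real (P s u) * f u) = l * f s"
  shows "Im l = 0 \<and> Re l \<in> kernel_spectrum S P"
proof -
  define N where "N = (\<Sum>s\<in>S. \<pi> s * (cmod (f s))\<^sup>2)"
  define E where "E = (\<Sum>s\<in>S. \<Sum>u\<in>S. of_real (\<pi> s * P s u) * (cnj (f s) * f u))"
  have "E = (\<Sum>s\<in>S. of_real (\<pi> s) * cnj (f s) * (\<Sum>u\<in>S. of_real (P s u) * f u))"
    unfolding E_def by (simp add: sum_distrib_left mult_ac)
  also have "\<dots> = (\<Sum>s\<in>S. of_real (\<pi> s) * cnj (f s) * (l * f s))"
    using ev by simp
  also have "\<dots> = l * (\<Sum>s\<in>S. of_real (\<pi> s * (cmod (f s))\<^sup>2))"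
    unfolding sum_distrib_left
    by (rule sum.cong) (simp_all add: complex_norm_square mult_ac del: of_real_power)
  also have "\<dots> = l * of_real N"
    unfolding N_def by simp
  finally have E: "E = l * of_real N" .
  have "cnj E = (\<Sum>s\<in>S. \<Sum>u\<in>S. of_real (\<pi> s * P s u) * (f s * cnj (f u)))"
    unfolding E_def by simp
  also have "\<dots> = (\<Sum>s\<in>S. \<Sum>u\<in>S. of_real (\<pi> u * P u s) * (f s * cnj (f u)))"
    using rev by (intro sum.cong refl) auto
  also have "\<dots> = E"
    unfolding E_def by (subst sum.swap) (simp add: mult_ac)
  finally have "Im E = 0"
    by (metis complex_cnj_cancel_iff Reals_cnj_iff complex_is_Real_iff)
  moreover have "N > 0"
  proof -
    obtain s where s: "s \<in> S" "f s \<noteq> 0" using nz by blast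
    show ?thesis unfolding N_def
      by (rule sum_pos2[OF fin s(1)]) (use s pos in \<open>auto simp: less_imp_le\<close>)
  qed
  ultimately have im: "Im l = 0"
    using E by simp
  have re_ev: "(\<Sum>u\<in>S. P s u * Re (f u)) = Re l * Re (f s)"
    and im_ev: "(\<Sum>u\<in>S. P s u * Im (f u)) = Re l * Im (f s)" if "s \<in> S" for s
    using arg_cong[OF ev[OF that], of Re] arg_cong[OF ev[OF that], of Im] im by simp_all
  obtain s where "s \<in> S" "Re (f s) \<noteq> 0 \<or> Im (f s) \<noteq> 0"
    using nz by (auto simp: complex_eq_iff)
  then have "Re l \<in> kernel_spectrum S P"
    unfolding kernel_spectrum_def using re_ev im_ev
    by (auto intro: exI[of _ "\<lambda>u. Re (f u)"] exI[of _ "\<lambda>u. Im (f u)"])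
  with im show ?thesis by simp
qed

text \<open>For an action \<open>\<phi>\<close> of \<open>G\<close> on \<open>X\<close>, the fixed-point set $X_g$ is \<open>invariants X \<phi> g\<close>, the
  stabilizer $G_x$ is \<open>stabilizer G \<phi> x\<close>, and $X/G$ is \<open>orbits G X \<phi>\<close>.\<close>

definition G_star :: "('g, 'b) monoid_scheme \<Rightarrow> 'x set \<Rightarrow> ('g \<Rightarrow> 'x \<Rightarrow> 'x) \<Rightarrow> 'g set" where
  "G_star G X \<phi> = {g \<in> carrier G. invariants X \<phi> g \<noteq> {}}"

definition burnside_K ::
    "('g, 'b) monoid_scheme \<Rightarrow> 'x set \<Rightarrow> ('g \<Rightarrow> 'x \<Rightarrow> 'x) \<Rightarrow> 'x \<Rightarrow> 'x \<Rightarrow> real" where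
  "burnside_K G X \<phi> x y =
     1 / real (card (stabilizer G \<phi> x)) *
     (\<Sum>g \<in> stabilizer G \<phi> x \<inter> stabilizer G \<phi> y. 1 / real (card (invariants X \<phi> g)))"

definition burnside_pi_K ::
    "('g, 'b) monoid_scheme \<Rightarrow> 'x set \<Rightarrow> ('g \<Rightarrow> 'x \<Rightarrow> 'x) \<Rightarrow> 'x \<Rightarrow> real" where
  "burnside_pi_K G X \<phi> x =
     real (card (stabilizer G \<phi> x)) / (real (order G) * real (card (orbits G X \<phi>)))"

definition burnside_Q ::
    "('g, 'b) monoid_scheme \<Rightarrow> 'x set \<Rightarrow> ('g \<Rightarrow> 'x \<Rightarrow> 'x) \<Rightarrow> 'g \<Rightarrow> 'g \<Rightarrow> real" where
  "burnside_Q G X \<phi> g h =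
     1 / real (card (invariants X \<phi> g)) *
     (\<Sum>x \<in> invariants X \<phi> g \<inter> invariants X \<phi> h. 1 / real (card (stabilizer G \<phi> x)))"

definition burnside_pi_Q ::
    "('g, 'b) monoid_scheme \<Rightarrow> 'x set \<Rightarrow> ('g \<Rightarrow> 'x \<Rightarrow> 'x) \<Rightarrow> 'g \<Rightarrow> real" where
  "burnside_pi_Q G X \<phi> g =
     real (card (invariants X \<phi> g)) / (real (order G) * real (card (orbits G X \<phi>)))"

end

theory Submission
  imports Defs "HOL-Analysis.Function_Topology" "Jordan_Normal_Form.Char_Poly"
begin

text \<open>
  Let \<open>A(x,h) = 1 / |G\<^sub>x|\<close> and \<open>B(h,x) = 1 / |X\<^sub>h|\<close> whenever \<open>h\<close> fixes \<open>x\<close>, and 0 otherwise. Then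
  \<open>K = A B\<close> and \<open>Q = B A\<close>, and \<open>A\<close>, \<open>B\<close> are in detailed balance with respect to the two stationary
  laws. Hence \<open>K\<close> and \<open>Q\<close> have the same nonzero eigenvalues, and both are positive semidefinite.
  By reversibility \<open>\<chi>\<^sup>2\<close> of \<open>Q\<close> at time \<open>t\<close> is read off the return probability
  \<open>Q\<^bsup>2t\<^esup> = B K\<^bsup>2t-1\<^esup> A\<close>, which gives the identity. If \<open>f\<close> is the centred density of \<open>K\<^bsup>t-1\<^esup>\<close>
  started uniformly on \<open>X\<^sub>g\<close>, the right-hand side is the quadratic form \<open>\<langle>f, K f\<rangle>\<close>, so the
  variational characterisation of \<open>\<lambda>\<^sub>1\<close> bounds it by \<open>\<lambda>\<^sub>1 \<parallel>f\<parallel>\<^sup>2\<close>, and convexity of the square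
  bounds \<open>\<parallel>f\<parallel>\<^sup>2\<close> by the average over \<open>X\<^sub>g\<close> of the \<open>\<chi>\<^sup>2\<close> of \<open>K\<close> at time \<open>t - 1\<close>.
\<close>

section \<open>Spectra and powers of kernels\<close>

text \<open>Enumerating \<open>S\<close> by \<open>e\<close> turns \<open>P\<close> into a square
  matrix, and its eigenvalues are roots of a nonzero characteristic polynomial. Finiteness makes the
  \<open>Max\<close> in \<open>lambda1\<close> a genuine maximum.\<close>

lemma finite_kernel_spectrum:
  assumes "finite S"
  shows "finite (kernel_spectrum S P)"
proof -
  obtain e where e: "bij_betw e {0..<card S} S"
    using assms ex_bij_betw_nat_finite by blast
  define n where "n = card S"
  define M where "M = mat n n (\<lambda>(i, j). P (e i) (e j))"
  have M: "M \<in> carrier_mat n n" by (simp add: M_def)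
  have eS: "e i \<in> S" if "i < n" for i
    using e that by (auto simp: n_def bij_betw_def)
  have "kernel_spectrum S P \<subseteq> {l. poly (char_poly M) l = 0}"
  proof
    fix l assume "l \<in> kernel_spectrum S P"
    then obtain f s where f: "\<And>s. s \<in> S \<Longrightarrow> (\<Sum>u\<in>S. P s u * f u) = l * f s"
      and s: "s \<in> S" "f s \<noteq> 0"
      unfolding kernel_spectrum_def by blast
    define v where "v = vec n (\<lambda>i. f (e i))"
    obtain i where i: "i < n" "e i = s"
      using s(1) e by (force simp: n_def bij_betw_def)
    have "v $ i \<noteq> 0\<^sub>v n $ i" using i s by (simp add: v_def)
    then have "v \<noteq> 0\<^sub>v n" by auto
    moreover have "M *\<^sub>v v = l \<cdot>\<^sub>v v"
    proof (rule eq_vecI)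
      fix i assume "i < dim_vec (l \<cdot>\<^sub>v v)"
      then have i: "i < n" by (simp add: v_def)
      have "(M *\<^sub>v v) $ i = (\<Sum>j\<in>{0..<n}. P (e i) (e j) * f (e j))"
        using i by (simp add: M_def v_def scalar_prod_def)
      also have "\<dots> = (\<Sum>u\<in>S. P (e i) u * f u)"
        unfolding n_def by (rule sum.reindex_bij_betw[OF e])
      finally show "(M *\<^sub>v v) $ i = (l \<cdot>\<^sub>v v) $ i"
        using f[OF eS[OF i]] i by (simp add: v_def)
    qed (simp add: M_def v_def)
    ultimately have "eigenvector M v l"
      unfolding eigenvector_def by (simp add: M_def v_def)
    then show "l \<in> {l. poly (char_poly M) l = 0}"
      using eigenvalue_root_char_poly[OF M] unfolding eigenvalue_def by blast
  qed
  moreover have "char_poly M \<noteq> 0"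
    using degree_monic_char_poly[OF M] by auto
  ultimately show ?thesis
    using poly_roots_finite finite_subset by blast
qed

lemma le_lambda1:
  assumes "finite S" "l \<in> kernel_spectrum S P" "l \<noteq> 1"
  shows "l \<le> lambda1 S P"
  using assms finite_kernel_spectrum[OF assms(1), of P]
  unfolding lambda1_def by (auto intro!: Max_ge)

text \<open>Chapman-Kolmogorov equation. The recursion of \<open>kernel_power\<close> splits off the
  first step only; this gives access to the last step as well.\<close>

lemma kernel_power_add:
  assumes "finite S" "s \<in> S"
  shows "kernel_power S P (m + n) s u
    = (\<Sum>v\<in>S. kernel_power S P m s v * kernel_power S P n v u)"
  using assms(2)
proof (induction m arbitrary: s)
  case 0
  then show ?case
    using assms(1) by (simp add: if_distrib[of "\<lambda>a. a * _"] cong: if_cong)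
next
  case (Suc m)
  have "kernel_power S P (Suc m + n) s u
    = (\<Sum>v\<in>S. \<Sum>w\<in>S. P s v * (kernel_power S P m v w * kernel_power S P n w u))"
    by (simp add: Suc.IH sum_distrib_left)
  also have "\<dots> = (\<Sum>w\<in>S. \<Sum>v\<in>S. P s v * (kernel_power S P m v w * kernel_power S P n w u))"
    by (rule sum.swap)
  finally show ?case
    by (simp add: sum_distrib_right mult.assoc)
qed

text \<open>Nonnegativity of the variance of \<open>a\<close> under the probability weights
  \<open>b\<close>.\<close>

lemma weighted_power2_mean_le:
  fixes b a :: "'a \<Rightarrow> real"
  assumes "\<And>x. x \<in> S \<Longrightarrow> b x \<ge> 0" "(\<Sum>x\<in>S. b x) = 1"
  shows "(\<Sum>x\<in>S. b x * a x)\<^sup>2 \<le> (\<Sum>x\<in>S. b x * (a x)\<^sup>2)"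
proof -
  define m where "m = (\<Sum>x\<in>S. b x * a x)"
  have "0 \<le> (\<Sum>x\<in>S. b x * (a x - m)\<^sup>2)"
    using assms(1) by (intro sum_nonneg) simp
  also have "\<dots> = (\<Sum>x\<in>S. b x * (a x)\<^sup>2 - 2 * m * (b x * a x) + m\<^sup>2 * b x)"
    by (intro sum.cong) (auto simp: power2_eq_square algebra_simps)
  also have "\<dots> = (\<Sum>x\<in>S. b x * (a x)\<^sup>2) - 2 * m * m + m\<^sup>2"
    using assms(2) by (simp add: sum.distrib sum_subtractf m_def flip: sum_distrib_left)
  finally show ?thesis by (simp add: m_def power2_eq_square)
qed

text \<open>Near 0 the linear term dominates, so a nonzero \<open>a\<close> would make the quadratic
  negative on one side of 0.\<close>

lemma linear_coeff_eq_0: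
  fixes a b :: real
  assumes "\<And>e. 0 \<le> 2 * e * a + e\<^sup>2 * b"
  shows "a = 0"
proof (rule ccontr)
  assume "a \<noteq> 0"
  \<comment> \<open>At \<open>e = - a / c\<close> the quadratic equals
    \<open>a\<^sup>2 / c\<^sup>2 * (b - 2 * c)\<close>, which is negative as soon as
    \<open>c\<close> is positive and exceeds \<open>b\<close>.\<close>
  define c where "c = \<bar>b\<bar> + 1"
  have c: "c > 0" "b < c" by (auto simp: c_def)
  have "2 * (- a / c) * a + (- a / c)\<^sup>2 * b = a\<^sup>2 / c\<^sup>2 * (b - 2 * c)"
    using c by (simp add: power2_eq_square field_simps)
  moreover have "\<dots> < 0"
    using c \<open>a \<noteq> 0\<close> by (intro mult_pos_neg) auto
  ultimately show False using assms[of "- a / c"] by linarith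
qed

section \<open>Reversible kernels\<close>

locale reversible_kernel =
  fixes S :: "'s set" and P :: "'s \<Rightarrow> 's \<Rightarrow> real" and \<pi> :: "'s \<Rightarrow> real"
  assumes finite_S: "finite S"
    and pi_pos: "s \<in> S \<Longrightarrow> \<pi> s > 0"
    and rev: "s \<in> S \<Longrightarrow> u \<in> S \<Longrightarrow> \<pi> s * P s u = \<pi> u * P u s"
    and row_sum: "s \<in> S \<Longrightarrow> (\<Sum>u\<in>S. P s u) = 1"
    and sum_pi: "(\<Sum>s\<in>S. \<pi> s) = 1"
begin

section \<open>Centred densities and the chi-squared distance\<close>

text \<open>With respect to the inner product weighted by \<open>\<pi>\<close>, this is the integral
  kernel of \<open>P^t\<close> minus the projection onto constants.\<close>

definition rel_density :: "nat \<Rightarrow> 's \<Rightarrow> 's \<Rightarrow> real" where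
  "rel_density t s u = kernel_power S P t s u / \<pi> u - 1"

lemma kernel_power_row_sum: "s \<in> S \<Longrightarrow> (\<Sum>u\<in>S. kernel_power S P t s u) = 1"
proof (induction t arbitrary: s)
  case 0
  then show ?case using finite_S by simp
next
  case (Suc t)
  have "(\<Sum>u\<in>S. kernel_power S P (Suc t) s u)
      = (\<Sum>v\<in>S. \<Sum>u\<in>S. P s v * kernel_power S P t v u)"
    by (simp, rule sum.swap)
  also have "\<dots> = (\<Sum>v\<in>S. P s v)"
    by (simp add: Suc.IH flip: sum_distrib_left)
  finally show ?case using Suc.prems row_sum by simp
qed

lemma kernel_power_rev:
  \<comment> \<open>Reversing a path turns its first step into its last, so the recursion is undone
    with \<open>kernel_power_add\<close> and a final single step.\<close>
  "s \<in> S \<Longrightarrow> u \<in> S \<Longrightarrow> \<pi> s * kernel_power S P t s u = \<pi> u * kernel_power S P t u s"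
proof (induction t arbitrary: s u)
  case 0
  then show ?case by simp
next
  case (Suc t)
  have one: "kernel_power S P (Suc 0) v w = P v w" if "w \<in> S" for v w
    using that finite_S by (simp add: if_distrib[of "\<lambda>a. _ * a"] cong: if_cong)
  have "\<pi> s * kernel_power S P (Suc t) s u = (\<Sum>v\<in>S. (\<pi> s * P s v) * kernel_power S P t v u)"
    by (simp add: sum_distrib_left mult.assoc)
  also have "\<dots> = (\<Sum>v\<in>S. P v s * (\<pi> v * kernel_power S P t v u))"
    using Suc.prems rev by (intro sum.cong) (auto simp: mult_ac)
  also have "\<dots> = (\<Sum>v\<in>S. \<pi> u * (kernel_power S P t u v * kernel_power S P (Suc 0) v s))"
    using Suc one by (intro sum.cong) auto
  also have "\<dots> = \<pi> u * kernel_power S P (t + Suc 0) u s"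
    using Suc.prems finite_S by (simp only: kernel_power_add sum_distrib_left)
  finally show ?case by (simp del: kernel_power.simps)
qed

lemma kernel_power_stationary:
  "u \<in> S \<Longrightarrow> (\<Sum>s\<in>S. \<pi> s * kernel_power S P t s u) = \<pi> u"
  using kernel_power_row_sum[of u t]
  by (simp add: kernel_power_rev[of _ u] flip: sum_distrib_left)

lemma stationary: "u \<in> S \<Longrightarrow> (\<Sum>s\<in>S. \<pi> s * P s u) = \<pi> u"
  using row_sum[of u] by (simp add: rev[of _ u] flip: sum_distrib_left)

lemma rel_density_mean: "s \<in> S \<Longrightarrow> (\<Sum>u\<in>S. \<pi> u * rel_density t s u) = 0"
proof -
  assume s: "s \<in> S"
  have "(\<Sum>u\<in>S. \<pi> u * rel_density t s u) = (\<Sum>u\<in>S. kernel_power S P t s u - \<pi> u)"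
  proof (intro sum.cong refl)
    fix u assume "u \<in> S"
    then show "\<pi> u * rel_density t s u = kernel_power S P t s u - \<pi> u"
      using pi_pos[of u] by (simp add: rel_density_def right_diff_distrib)
  qed
  then show ?thesis using s kernel_power_row_sum sum_pi by (simp add: sum_subtractf)
qed

lemma rel_density_sym: "s \<in> S \<Longrightarrow> u \<in> S \<Longrightarrow> rel_density t s u = rel_density t u s"
  using kernel_power_rev[of s u t] pi_pos[of s] pi_pos[of u]
  by (simp add: rel_density_def field_simps)

text \<open>Symmetry moves \<open>s\<close> to the second slot, so that \<open>P\<close> acts on the
  starting point, where the recursion of \<open>kernel_power\<close> applies. The constant 1
  survives because rows sum to 1.\<close>

lemma rel_density_step:
  assumes "s \<in> S" "u \<in> S"
  shows "(\<Sum>v\<in>S. P u v * rel_density t s v) = rel_density (Suc t) s u"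
proof -
  have "(\<Sum>v\<in>S. P u v * rel_density t s v) = (\<Sum>v\<in>S. P u v * rel_density t v s)"
    using assms rel_density_sym by (intro sum.cong) auto
  also have "\<dots> = (\<Sum>v\<in>S. P u v * kernel_power S P t v s) / \<pi> s - 1"
    using assms row_sum
    by (simp add: rel_density_def right_diff_distrib sum_subtractf sum_divide_distrib)
  also have "\<dots> = rel_density (Suc t) u s" by (simp add: rel_density_def)
  finally show ?thesis using assms rel_density_sym by simp
qed

text \<open>In operator form: \<open>(P^m - J) (P^n - J) = P^(m+n) - J\<close>, where
  \<open>J\<close> is the projection onto constants.\<close>

lemma rel_density_inner:
  assumes "x \<in> S" "y \<in> S"
  shows "(\<Sum>u\<in>S. \<pi> u * rel_density m x u * rel_density n y u) = rel_density (m + n) x y"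
proof -
  have "(\<Sum>u\<in>S. \<pi> u * rel_density m x u * rel_density n y u)
      = (\<Sum>u\<in>S. \<pi> u * rel_density m x u * rel_density n u y)"
    using assms rel_density_sym by (intro sum.cong) auto
  also have "\<dots> = (\<Sum>u\<in>S. kernel_power S P m x u * kernel_power S P n u y / \<pi> y
        - \<pi> u * kernel_power S P n u y / \<pi> y - kernel_power S P m x u + \<pi> u)"
  proof (intro sum.cong refl)
    fix u assume "u \<in> S"
    then show "\<pi> u * rel_density m x u * rel_density n u y =
        kernel_power S P m x u * kernel_power S P n u y / \<pi> y
        - \<pi> u * kernel_power S P n u y / \<pi> y - kernel_power S P m x u + \<pi> u"
      using pi_pos[of u] pi_pos[OF assms(2)] by (simp add: rel_density_def field_simps)
  qed
  \<comment> \<open>The three correction sums contribute -1, -1 and +1.\<close>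
  also have "\<dots> = (\<Sum>u\<in>S. kernel_power S P m x u * kernel_power S P n u y) / \<pi> y
        - (\<Sum>u\<in>S. \<pi> u * kernel_power S P n u y) / \<pi> y - (\<Sum>u\<in>S. kernel_power S P m x u)
        + (\<Sum>u\<in>S. \<pi> u)"
    by (simp only: sum.distrib sum_subtractf sum_divide_distrib)
  also have "\<dots> = rel_density (m + n) x y"
    using assms kernel_power_stationary[of y n] kernel_power_row_sum[of x m] sum_pi
      pi_pos[of y] kernel_power_add[OF finite_S assms(1), of P m n y]
    by (simp add: rel_density_def)
  finally show ?thesis .
qed

lemma chi_sq_eq_rel_density:
  "chi_sq S P \<pi> s t = (\<Sum>u\<in>S. \<pi> u * (rel_density t s u)\<^sup>2)"
  unfolding chi_sq_def
proof (intro sum.cong refl)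
  fix u assume "u \<in> S"
  then show "(kernel_power S P t s u - \<pi> u)\<^sup>2 / \<pi> u = \<pi> u * (rel_density t s u)\<^sup>2"
    using pi_pos[of u] by (simp add: rel_density_def power2_eq_square field_simps)
qed

lemma chi_sq_eq_return:
  "s \<in> S \<Longrightarrow> chi_sq S P \<pi> s t = rel_density (t + t) s s"
  using rel_density_inner[of s s t t]
  by (simp add: chi_sq_eq_rel_density power2_eq_square mult.assoc)

section \<open>The quadratic form and the variational principle\<close>

text \<open>The inner product of \<open>f\<close> with \<open>P h\<close> weighted by
  \<open>\<pi>\<close>; this is not the Dirichlet form, which belongs to
  \<open>I - P\<close>.\<close>

definition energy :: "('s \<Rightarrow> real) \<Rightarrow> ('s \<Rightarrow> real) \<Rightarrow> real" where
  "energy f h = (\<Sum>s\<in>S. \<Sum>u\<in>S. \<pi> s * P s u * f s * h u)"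

lemma energy_sym: "energy f h = energy h f"
  unfolding energy_def
  by (subst sum.swap, intro sum.cong refl) (simp add: rev mult_ac)

lemma energy_eq: "energy f h = (\<Sum>s\<in>S. \<pi> s * f s * (\<Sum>u\<in>S. P s u * h u))"
  by (simp add: energy_def sum_distrib_left mult_ac)

lemma energy_eigen:
  assumes "\<And>s. s \<in> S \<Longrightarrow> (\<Sum>u\<in>S. P s u * f u) = l * f s"
  shows "energy f f = l * (\<Sum>s\<in>S. \<pi> s * (f s)\<^sup>2)"
proof -
  have "energy f f = (\<Sum>s\<in>S. l * (\<pi> s * (f s)\<^sup>2))"
    unfolding energy_eq by (intro sum.cong) (auto simp: assms power2_eq_square)
  then show ?thesis by (simp add: sum_distrib_left)
qed

lemma sum_pi_power2_pos:
  assumes "s \<in> S" "f s \<noteq> 0"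
  shows "(\<Sum>s\<in>S. \<pi> s * (f s)\<^sup>2) > 0"
  by (rule sum_pos2[OF finite_S assms(1)])
     (use assms pi_pos in \<open>auto simp: less_imp_le\<close>)

text \<open>Stationarity of \<open>\<pi>\<close>. In particular \<open>P\<close> preserves the space
  of functions of mean zero.\<close>

lemma mean_step:
  "(\<Sum>s\<in>S. \<pi> s * (\<Sum>u\<in>S. P s u * f u)) = (\<Sum>s\<in>S. \<pi> s * f s)"
proof -
  have "(\<Sum>s\<in>S. \<pi> s * (\<Sum>u\<in>S. P s u * f u)) = (\<Sum>u\<in>S. (\<Sum>s\<in>S. \<pi> s * P s u) * f u)"
    by (simp add: sum_distrib_left sum_distrib_right mult.assoc, rule sum.swap)
  then show ?thesis by (simp add: stationary)
qed

lemma energy_add_scaled: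
  "energy (\<lambda>s. f s + e * h s) (\<lambda>s. f s + e * h s)
    = energy f f + 2 * e * energy f h + e\<^sup>2 * energy h h"
proof -
  have "energy (\<lambda>s. f s + e * h s) (\<lambda>s. f s + e * h s)
      = energy f f + e * energy f h + e * energy h f + e\<^sup>2 * energy h h"
    unfolding energy_def sum_distrib_left sum.distrib[symmetric]
    by (intro sum.cong refl) (simp add: power2_eq_square algebra_simps)
  then show ?thesis by (simp add: energy_sym[of h f])
qed

text \<open>The Rayleigh quotient attains its maximum on the compact unit sphere of mean-zero
  functions, and homogeneity extends the bound to every \<open>k\<close>. The function
  \<open>f\<close> guarantees that the sphere is nonempty.\<close>

lemma exists_energy_maximizer:
  assumes "\<exists>s\<in>S. f s \<noteq> 0" "(\<Sum>s\<in>S. \<pi> s * f s) = 0"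
  obtains h where "(\<Sum>s\<in>S. \<pi> s * h s) = 0" "(\<Sum>s\<in>S. \<pi> s * (h s)\<^sup>2) = 1"
    "\<And>k. (\<Sum>s\<in>S. \<pi> s * k s) = 0
      \<Longrightarrow> energy k k \<le> energy h h * (\<Sum>s\<in>S. \<pi> s * (k s)\<^sup>2)"
proof -
  define N where "N k = (\<Sum>s\<in>S. \<pi> s * (k s)\<^sup>2)" for k :: "'s \<Rightarrow> real"
  \<comment> \<open>Pinning the irrelevant coordinates to 0 makes the unit sphere compact in the product topology.\<close>
  define B where "B s = (if s \<in> S then {- 1 / sqrt (\<pi> s)..1 / sqrt (\<pi> s)} else {0})" for s
  define C where "C = {k. (\<forall>s. k s \<in> B s) \<and> (\<Sum>s\<in>S. \<pi> s * k s) = 0 \<and> N k = 1}"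
  have "compact (PiE UNIV B)"
    using compactin_PiE[of "\<lambda>_. euclidean" UNIV B]
    by (simp add: euclidean_product_topology B_def)
  moreover have "closed {k. (\<Sum>s\<in>S. \<pi> s * k s) = 0 \<and> N k = 1}"
    unfolding N_def
    by (intro closed_Collect_conj closed_Collect_eq continuous_intros
        continuous_on_product_then_coordinatewise continuous_on_id)
  moreover have "C = PiE UNIV B \<inter> {k. (\<Sum>s\<in>S. \<pi> s * k s) = 0 \<and> N k = 1}"
    by (auto simp: C_def PiE_UNIV_domain)
  ultimately have "compact C"
    by (simp add: compact_Int_closed)
  have C_I: "(\<lambda>s. if s \<in> S then k s / sqrt (N k) else 0) \<in> C"
    if "(\<Sum>s\<in>S. \<pi> s * k s) = 0" "N k > 0" for k
  proof -
    let ?k = "\<lambda>s. if s \<in> S then k s / sqrt (N k) else 0"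
    have "?k s \<in> B s" for s
    proof (cases "s \<in> S")
      case True
      \<comment> \<open>A single term is at most the whole squared norm; this is the origin of the
        half-width \<open>1 / sqrt (\<pi> s)\<close> of the box.\<close>
      then have "\<pi> s * (k s)\<^sup>2 \<le> N k"
        unfolding N_def using finite_S pi_pos
        by (intro member_le_sum) (auto simp: less_imp_le)
      then have "sqrt (\<pi> s) * \<bar>k s\<bar> \<le> sqrt (N k)"
        using real_sqrt_le_mono by (fastforce simp: real_sqrt_mult)
      then have "\<bar>k s / sqrt (N k)\<bar> \<le> 1 / sqrt (\<pi> s)"
        using pi_pos[OF True] that(2) by (simp add: field_simps)
      then have "- 1 / sqrt (\<pi> s) \<le> k s / sqrt (N k)" "k s / sqrt (N k) \<le> 1 / sqrt (\<pi> s)"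
        by linarith+
      then show ?thesis using True by (simp add: B_def)
    qed (simp add: B_def)
    moreover have "(\<Sum>s\<in>S. \<pi> s * ?k s) = 0"
    proof -
      have "(\<Sum>s\<in>S. \<pi> s * ?k s) = (\<Sum>s\<in>S. \<pi> s * k s) / sqrt (N k)"
        unfolding sum_divide_distrib by (intro sum.cong) auto
      then show ?thesis using that by simp
    qed
    moreover have "N ?k = 1"
    proof -
      have "N ?k = N k / N k"
        unfolding N_def[of ?k] using that(2)
        by (subst (2) N_def, unfold sum_divide_distrib, intro sum.cong)
           (auto simp: power_divide)
      then show ?thesis using that by simp
    qed
    ultimately show ?thesis by (simp add: C_def)
  qed
  have "N f > 0" using assms(1) sum_pi_power2_pos unfolding N_def by blast
  then have "C \<noteq> {}" using C_I assms(2) by blast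
  moreover have "continuous_on C (\<lambda>k. energy k k)"
    unfolding energy_def
    by (intro continuous_intros continuous_on_product_then_coordinatewise continuous_on_id)
  ultimately obtain h where h: "h \<in> C" "\<And>k. k \<in> C \<Longrightarrow> energy k k \<le> energy h h"
    using continuous_attains_sup[OF \<open>compact C\<close>] by blast
  show thesis
  proof
    show "(\<Sum>s\<in>S. \<pi> s * h s) = 0" "(\<Sum>s\<in>S. \<pi> s * (h s)\<^sup>2) = 1"
      using h(1) by (auto simp: C_def N_def)
    fix k assume k: "(\<Sum>s\<in>S. \<pi> s * k s) = 0"
    have "energy k k \<le> energy h h * N k"
    proof (cases "\<exists>s\<in>S. k s \<noteq> 0")
      case True
      then have pos: "N k > 0" using sum_pi_power2_pos unfolding N_def by blast
      let ?k = "\<lambda>s. if s \<in> S then k s / sqrt (N k) else 0"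
      have "energy ?k ?k = energy k k / N k"
        unfolding energy_def sum_divide_distrib using pos by (intro sum.cong) auto
      then show ?thesis using h(2)[OF C_I[OF k pos]] pos by (simp add: pos_divide_le_eq)
    qed (simp add: energy_def N_def)
    then show "energy k k \<le> energy h h * (\<Sum>s\<in>S. \<pi> s * (k s)\<^sup>2)" by (simp add: N_def)
  qed
qed

lemma energy_maximizer_eigenfunction:
  assumes mean: "(\<Sum>s\<in>S. \<pi> s * h s) = 0" and norm: "(\<Sum>s\<in>S. \<pi> s * (h s)\<^sup>2) = 1"
    and max: "\<And>k. (\<Sum>s\<in>S. \<pi> s * k s) = 0
      \<Longrightarrow> energy k k \<le> energy h h * (\<Sum>s\<in>S. \<pi> s * (k s)\<^sup>2)"
    and s: "s \<in> S"
  shows "(\<Sum>u\<in>S. P s u * h u) = energy h h * h s"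
proof -
  define l where "l = energy h h"
  \<comment> \<open>First variation at \<open>h\<close> in the direction of its own defect \<open>d\<close>.\<close>
  define d where "d s = l * h s - (\<Sum>u\<in>S. P s u * h u)" for s
  \<comment> \<open>The perturbed function \<open>h + e d\<close> thus stays admissible in
    \<open>max\<close>.\<close>
  have d0: "(\<Sum>s\<in>S. \<pi> s * d s) = 0"
  proof -
    have "(\<Sum>s\<in>S. \<pi> s * d s) = l * (\<Sum>s\<in>S. \<pi> s * h s) - (\<Sum>s\<in>S. \<pi> s * (\<Sum>u\<in>S. P s u * h u))"
      unfolding d_def sum_distrib_left[of l] sum_subtractf[symmetric]
      by (intro sum.cong) (auto simp: algebra_simps)
    then show ?thesis by (simp add: mean mean_step)
  qed
  \<comment> \<open>This identifies the linear coefficient of the variation with the squared norm of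
    the defect, using the symmetry of \<open>energy\<close>.\<close>
  have first: "l * (\<Sum>s\<in>S. \<pi> s * h s * d s) - energy h d = (\<Sum>s\<in>S. \<pi> s * (d s)\<^sup>2)"
  proof -
    have "\<pi> s * (d s)\<^sup>2 = l * (\<pi> s * h s * d s) - \<pi> s * d s * (\<Sum>u\<in>S. P s u * h u)" for s
    proof -
      have "d s * d s = d s * (l * h s - (\<Sum>u\<in>S. P s u * h u))" by (simp add: d_def)
      then show ?thesis by (simp only: power2_eq_square) (simp only: algebra_simps)
    qed
    then show ?thesis
      unfolding energy_sym[of h d] unfolding energy_eq by (simp add: sum_distrib_left[of l] sum_subtractf)
  qed
  have "(\<Sum>s\<in>S. \<pi> s * (d s)\<^sup>2) = 0"
  proof (rule linear_coeff_eq_0)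
    fix e
    let ?k = "\<lambda>s. h s + e * d s"
    have "(\<Sum>s\<in>S. \<pi> s * ?k s) = (\<Sum>s\<in>S. \<pi> s * h s) + e * (\<Sum>s\<in>S. \<pi> s * d s)"
      unfolding sum_distrib_left[of e] sum.distrib[symmetric]
      by (intro sum.cong) (auto simp: algebra_simps)
    then have "energy ?k ?k \<le> l * (\<Sum>s\<in>S. \<pi> s * (?k s)\<^sup>2)"
      using max[of ?k] mean d0 by (simp add: l_def)
    moreover have "(\<Sum>s\<in>S. \<pi> s * (?k s)\<^sup>2)
      = (\<Sum>s\<in>S. \<pi> s * (h s)\<^sup>2) + 2 * e * (\<Sum>s\<in>S. \<pi> s * h s * d s) + e\<^sup>2 * (\<Sum>s\<in>S. \<pi> s * (d s)\<^sup>2)"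
      unfolding sum_distrib_left[of "2 * e"] sum_distrib_left[of "e\<^sup>2"] sum.distrib[symmetric]
      by (intro sum.cong) (auto simp: power2_eq_square algebra_simps)
    \<comment> \<open>Since \<open>h\<close> has norm 1, the terms of order 0 in \<open>e\<close>
      are \<open>l\<close> on both sides and cancel.\<close>
    ultimately have "l + 2 * e * energy h d + e\<^sup>2 * energy d d
        \<le> l * (1 + 2 * e * (\<Sum>s\<in>S. \<pi> s * h s * d s) + e\<^sup>2 * (\<Sum>s\<in>S. \<pi> s * (d s)\<^sup>2))"
      using norm unfolding energy_add_scaled l_def by simp
    then show "0 \<le> 2 * e * (\<Sum>s\<in>S. \<pi> s * (d s)\<^sup>2)
        + e\<^sup>2 * (l * (\<Sum>s\<in>S. \<pi> s * (d s)\<^sup>2) - energy d d)"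
      unfolding first[symmetric] by (simp add: algebra_simps)
  qed
  then have "d s = 0"
    using sum_pi_power2_pos[OF s, of d] by linarith
  then show ?thesis by (simp add: d_def l_def)
qed

text \<open>Maximum principle: at a maximum point, \<open>f\<close> is an average with strictly
  positive weights of values that are no larger, so \<open>f\<close> is constant on
  \<open>S\<close>.\<close>

lemma harmonic_mean_zero:
  assumes P_pos: "\<And>s u. s \<in> S \<Longrightarrow> u \<in> S \<Longrightarrow> P s u > 0"
    and harm: "\<And>s. s \<in> S \<Longrightarrow> (\<Sum>u\<in>S. P s u * f u) = f s"
    and mean: "(\<Sum>s\<in>S. \<pi> s * f s) = 0" and s: "s \<in> S"
  shows "f s = 0"
proof -
  have "Max (f ` S) \<in> f ` S" using finite_S s by (intro Max_in) auto
  then obtain m where m: "m \<in> S" "f m = Max (f ` S)" by auto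
  then have le: "f u \<le> f m" if "u \<in> S" for u using that finite_S by simp
  have "(\<Sum>u\<in>S. P m u * (f m - f u)) = 0"
    using harm[OF m(1)] row_sum[OF m(1)]
    by (simp add: right_diff_distrib sum_subtractf flip: sum_distrib_right)
  then have "\<forall>u\<in>S. P m u * (f m - f u) = 0"
    using finite_S le P_pos[OF m(1)] by (subst (asm) sum_nonneg_eq_0_iff) (auto simp: less_imp_le)
  then have const: "f u = f m" if "u \<in> S" for u
    using that P_pos[OF m(1) that] by auto
  then have "(\<Sum>s\<in>S. \<pi> s * f s) = f m"
    by (simp add: sum_pi flip: sum_distrib_right)
  then show ?thesis using mean const s by simp
qed

text \<open>The maximal Rayleigh quotient on mean-zero functions is an eigenvalue different from 1,
  hence at most \<open>lambda1\<close>.\<close>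

lemma energy_le_lambda1:
  assumes P_pos: "\<And>s u. s \<in> S \<Longrightarrow> u \<in> S \<Longrightarrow> P s u > 0"
    and mean: "(\<Sum>s\<in>S. \<pi> s * f s) = 0"
  shows "energy f f \<le> lambda1 S P * (\<Sum>s\<in>S. \<pi> s * (f s)\<^sup>2)"
proof (cases "\<exists>s\<in>S. f s \<noteq> 0")
  case True
  obtain h where h: "(\<Sum>s\<in>S. \<pi> s * h s) = 0" "(\<Sum>s\<in>S. \<pi> s * (h s)\<^sup>2) = 1"
    "\<And>k. (\<Sum>s\<in>S. \<pi> s * k s) = 0
      \<Longrightarrow> energy k k \<le> energy h h * (\<Sum>s\<in>S. \<pi> s * (k s)\<^sup>2)"
    using exists_energy_maximizer[OF True mean] by blast
  note eig = energy_maximizer_eigenfunction[OF h]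
  have nz: "\<exists>s\<in>S. h s \<noteq> 0"
  proof (rule ccontr)
    assume "\<not> (\<exists>s\<in>S. h s \<noteq> 0)"
    then have "(\<Sum>s\<in>S. \<pi> s * (h s)\<^sup>2) = 0" by simp
    then show False using h(2) by simp
  qed
  then have "energy h h \<in> kernel_spectrum S P"
    using eig unfolding kernel_spectrum_def by blast
  \<comment> \<open>Otherwise \<open>h\<close> would be harmonic of mean zero and vanish on
    \<open>S\<close>.\<close>
  moreover have "energy h h \<noteq> 1"
    using harmonic_mean_zero[OF P_pos _ h(1)] eig nz by auto
  ultimately have "energy h h \<le> lambda1 S P"
    using finite_S le_lambda1 by blast
  then have "energy h h * (\<Sum>s\<in>S. \<pi> s * (f s)\<^sup>2) \<le> lambda1 S P * (\<Sum>s\<in>S. \<pi> s * (f s)\<^sup>2)"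
    by (intro mult_right_mono sum_nonneg) (auto simp: less_imp_le pi_pos)
  then show ?thesis using h(3)[OF mean] by linarith
qed (simp add: energy_def)

end

section \<open>Pairs of dual kernels\<close>

text \<open>A walk on a bipartite graph with half-steps \<open>A\<close> and \<open>B\<close>,
  observed on either side. The condition \<open>balance\<close> says that \<open>A\<close> and
  \<open>B\<close> are adjoint with respect to \<open>\<pi>\<close> and
  \<open>\<rho>\<close>.\<close>

locale dual_kernels =
  fixes S :: "'s set" and T :: "'t set" and A :: "'s \<Rightarrow> 't \<Rightarrow> real" and B :: "'t \<Rightarrow> 's \<Rightarrow> real"
    and P :: "'s \<Rightarrow> 's \<Rightarrow> real" and Q :: "'t \<Rightarrow> 't \<Rightarrow> real"
    and \<pi> :: "'s \<Rightarrow> real" and \<rho> :: "'t \<Rightarrow> real"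
  assumes finite_S: "finite S" and finite_T: "finite T"
    and pi_pos: "x \<in> S \<Longrightarrow> \<pi> x > 0" and rho_pos: "g \<in> T \<Longrightarrow> \<rho> g > 0"
    and A_sum: "x \<in> S \<Longrightarrow> (\<Sum>g\<in>T. A x g) = 1" and B_sum: "g \<in> T \<Longrightarrow> (\<Sum>x\<in>S. B g x) = 1"
    and B_nonneg: "g \<in> T \<Longrightarrow> x \<in> S \<Longrightarrow> B g x \<ge> 0"
    and balance: "x \<in> S \<Longrightarrow> g \<in> T \<Longrightarrow> \<pi> x * A x g = \<rho> g * B g x"
    and sum_pi: "(\<Sum>x\<in>S. \<pi> x) = 1"
    and P_eq: "x \<in> S \<Longrightarrow> y \<in> S \<Longrightarrow> P x y = (\<Sum>g\<in>T. A x g * B g y)"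
    and Q_eq: "g \<in> T \<Longrightarrow> h \<in> T \<Longrightarrow> Q g h = (\<Sum>x\<in>S. B g x * A x h)"
begin

lemma sum_rho: "(\<Sum>g\<in>T. \<rho> g) = 1"
proof -
  have "(\<Sum>g\<in>T. \<rho> g) = (\<Sum>g\<in>T. \<Sum>x\<in>S. \<rho> g * B g x)"
    by (simp add: B_sum flip: sum_distrib_left)
  also have "\<dots> = (\<Sum>x\<in>S. \<Sum>g\<in>T. \<pi> x * A x g)"
    by (subst sum.swap) (simp add: balance)
  also have "\<dots> = 1"
    by (simp add: A_sum sum_pi flip: sum_distrib_left)
  finally show ?thesis .
qed

lemma A_nonneg: "x \<in> S \<Longrightarrow> g \<in> T \<Longrightarrow> A x g \<ge> 0"
  using balance[of x g] B_nonneg[of g x] rho_pos[of g] pi_pos[of x]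
  by (metis less_imp_le mult_nonneg_nonneg zero_le_mult_iff not_le)

text \<open>Self-duality: with \<open>sum_rho\<close> and \<open>A_nonneg\<close> the assumptions
  hold for both sides, so every result about \<open>P\<close> also holds for
  \<open>Q\<close>.\<close>

lemma swap: "dual_kernels T S B A Q P \<rho> \<pi>"
  by unfold_locales
    (simp_all add: finite_S finite_T pi_pos rho_pos A_sum B_sum A_nonneg balance sum_rho P_eq Q_eq)

text \<open>A Gram matrix: its symmetry is the reversibility of \<open>P\<close>, and its form
  yields positive semidefiniteness.\<close>

lemma pi_P: "x \<in> S \<Longrightarrow> y \<in> S \<Longrightarrow> \<pi> x * P x y = (\<Sum>g\<in>T. \<rho> g * B g x * B g y)"
  by (simp add: P_eq sum_distrib_left balance flip: mult.assoc)

sublocale P: reversible_kernel S P \<pi>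
proof
  fix x y assume xy: "x \<in> S" "y \<in> S"
  show "\<pi> x * P x y = \<pi> y * P y x"
    using xy by (simp add: pi_P mult_ac)
next
  fix x assume x: "x \<in> S"
  have "(\<Sum>y\<in>S. P x y) = (\<Sum>g\<in>T. \<Sum>y\<in>S. A x g * B g y)"
    using x by (simp add: P_eq, subst sum.swap) simp
  also have "\<dots> = 1" using x by (simp add: A_sum B_sum flip: sum_distrib_left)
  finally show "(\<Sum>y\<in>S. P x y) = 1" .
qed (auto simp: finite_S pi_pos sum_pi)

text \<open>The energy of \<open>f\<close> is the squared norm of \<open>B f\<close> weighted by
  \<open>\<rho>\<close>.\<close>

lemma P_energy_nonneg: "P.energy f f \<ge> 0"
proof -
  have "P.energy f f = (\<Sum>x\<in>S. \<Sum>y\<in>S. \<Sum>g\<in>T. \<rho> g * (B g x * f x) * (B g y * f y))"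
    unfolding P.energy_def
    by (intro sum.cong refl) (simp add: pi_P sum_distrib_left mult_ac)
  also have "\<dots> = (\<Sum>x\<in>S. \<Sum>g\<in>T. \<Sum>y\<in>S. \<rho> g * (B g x * f x) * (B g y * f y))"
    by (intro sum.cong refl sum.swap)
  also have "\<dots> = (\<Sum>g\<in>T. \<Sum>x\<in>S. \<Sum>y\<in>S. \<rho> g * (B g x * f x) * (B g y * f y))"
    by (rule sum.swap)
  also have "\<dots> = (\<Sum>g\<in>T. \<rho> g * (\<Sum>x\<in>S. B g x * f x)\<^sup>2)"
    by (simp add: power2_eq_square sum_product sum_distrib_left mult_ac)
  also have "\<dots> \<ge> 0" by (intro sum_nonneg) (simp add: rho_pos less_imp_le)
  finally show ?thesis .
qed

section \<open>Comparison of the two spectra\<close>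

lemma spectrum_P_nonneg:
  assumes "l \<in> kernel_spectrum S P"
  shows "l \<ge> 0"
proof -
  obtain f s where f: "\<And>s. s \<in> S \<Longrightarrow> (\<Sum>u\<in>S. P s u * f u) = l * f s"
    and s: "s \<in> S" "f s \<noteq> 0"
    using assms unfolding kernel_spectrum_def by blast
  show ?thesis
    using P_energy_nonneg[of f] P.energy_eigen[OF f] P.sum_pi_power2_pos[of s f] s
    by (simp add: zero_le_mult_iff)
qed

text \<open>If \<open>P f = l f\<close>, then \<open>h = B f\<close> satisfies
  \<open>Q h = B A B f = B P f = l h\<close>, and \<open>h\<close> is nonzero because
  \<open>A h = l f\<close>.\<close>

lemma spectrum_P_imp_Q:
  assumes "l \<in> kernel_spectrum S P" "l \<noteq> 0"
  shows "l \<in> kernel_spectrum T Q"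
proof -
  obtain f s where f: "\<And>s. s \<in> S \<Longrightarrow> (\<Sum>u\<in>S. P s u * f u) = l * f s"
    and s: "s \<in> S" "f s \<noteq> 0"
    using assms unfolding kernel_spectrum_def by blast
  define h where "h g = (\<Sum>x\<in>S. B g x * f x)" for g
  have Ah: "(\<Sum>g\<in>T. A x g * h g) = l * f x" if "x \<in> S" for x
  proof -
    have "(\<Sum>g\<in>T. A x g * h g) = (\<Sum>y\<in>S. \<Sum>g\<in>T. A x g * B g y * f y)"
      unfolding h_def by (simp add: sum_distrib_left mult.assoc, rule sum.swap)
    also have "\<dots> = (\<Sum>y\<in>S. P x y * f y)"
      using that by (simp add: P_eq sum_distrib_right)
    finally show ?thesis using f that by simp
  qed
  have "\<exists>g\<in>T. h g \<noteq> 0"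
  proof (rule ccontr)
    assume "\<not> (\<exists>g\<in>T. h g \<noteq> 0)"
    then have "(\<Sum>g\<in>T. A s g * h g) = 0" by simp
    then show False using Ah[OF s(1)] s assms(2) by simp
  qed
  moreover have "(\<Sum>k\<in>T. Q g k * h k) = l * h g" if "g \<in> T" for g
  proof -
    have "(\<Sum>k\<in>T. Q g k * h k) = (\<Sum>x\<in>S. \<Sum>k\<in>T. B g x * (A x k * h k))"
      using that by (simp add: Q_eq sum_distrib_right mult.assoc, subst sum.swap) simp
    also have "\<dots> = (\<Sum>x\<in>S. B g x * (l * f x))"
      by (simp add: Ah flip: sum_distrib_left)
    finally show ?thesis by (simp add: h_def sum_distrib_left mult_ac)
  qed
  ultimately show ?thesis unfolding kernel_spectrum_def by blast
qed

text \<open>Either the default value 0 applies or some nonnegative eigenvalue competes in the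
  maximum.\<close>

lemma lambda1_P_nonneg: "lambda1 S P \<ge> 0"
proof (cases "kernel_spectrum S P \<subseteq> {1}")
  case False
  then obtain l where l: "l \<in> kernel_spectrum S P" "l \<noteq> 1" by auto
  show ?thesis
    using le_lambda1[OF finite_S l] spectrum_P_nonneg[OF l(1)] by simp
qed (simp add: lambda1_def)

section \<open>Chi-squared distance of the dual kernel\<close>

text \<open>Regrouping of factors: \<open>(B A)^(n+1) = B (A B)^n A\<close>.\<close>

lemma kernel_power_Q_Suc:
  "g \<in> T \<Longrightarrow> h \<in> T \<Longrightarrow> kernel_power T Q (Suc n) g h
    = (\<Sum>x\<in>S. \<Sum>y\<in>S. B g x * kernel_power S P n x y * A y h)"
proof (induction n arbitrary: g)
  case 0
  then show ?case
    using finite_S finite_T Q_eq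
    by (simp add: if_distrib[of "\<lambda>a. _ * a"] if_distrib[of "\<lambda>a. a * _"] cong: if_cong)
next
  case (Suc n)
  have "kernel_power T Q (Suc (Suc n)) g h
      = (\<Sum>k\<in>T. (\<Sum>z\<in>S. B g z * A z k) * (\<Sum>x\<in>S. \<Sum>y\<in>S. B k x * kernel_power S P n x y * A y h))"
    using Suc by (simp add: Q_eq del: kernel_power.simps add: kernel_power.simps(2)[of T Q "Suc n"])
  also have "\<dots> = (\<Sum>k\<in>T. \<Sum>z\<in>S. \<Sum>x\<in>S. \<Sum>y\<in>S. B g z * A z k * B k x * kernel_power S P n x y * A y h)"
    by (rule sum.cong[OF refl], subst sum_distrib_right) (simp add: sum_distrib_left mult_ac)
  \<comment> \<open>With the sum over \<open>k\<close> innermost, \<open>A z k * B k x\<close>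
    collapses to \<open>P z x\<close>.\<close>
  also have "\<dots> = (\<Sum>z\<in>S. \<Sum>x\<in>S. \<Sum>y\<in>S. \<Sum>k\<in>T. B g z * A z k * B k x * kernel_power S P n x y * A y h)"
    by (subst sum.swap, intro sum.cong refl, subst sum.swap, intro sum.cong refl, rule sum.swap)
  also have "\<dots> = (\<Sum>z\<in>S. \<Sum>x\<in>S. \<Sum>y\<in>S. B g z * (P z x * kernel_power S P n x y) * A y h)"
    by (intro sum.cong refl) (simp add: P_eq sum_distrib_left sum_distrib_right mult_ac)
  also have "\<dots> = (\<Sum>z\<in>S. \<Sum>y\<in>S. \<Sum>x\<in>S. B g z * (P z x * kernel_power S P n x y) * A y h)"
    by (rule sum.cong[OF refl], rule sum.swap)
  also have "\<dots> = (\<Sum>z\<in>S. \<Sum>y\<in>S. B g z * kernel_power S P (Suc n) z y * A y h)"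
    by (simp add: sum_distrib_left sum_distrib_right)
  finally show ?case .
qed

interpretation D: dual_kernels T S B A Q P \<rho> \<pi>
  by (rule swap)

text \<open>Nonzero eigenvalues transfer to \<open>Q\<close>. If \<open>lambda1 S P\<close> is 0, as
  an eigenvalue or by default, nonnegativity on the side of \<open>Q\<close> suffices.\<close>

lemma lambda1_P_le: "lambda1 S P \<le> lambda1 T Q"
proof (cases "kernel_spectrum S P \<subseteq> {1}")
  case True
  then show ?thesis using D.lambda1_P_nonneg by (simp add: lambda1_def)
next
  case False
  then have "Max {l \<in> kernel_spectrum S P. l \<noteq> 1} \<in> {l \<in> kernel_spectrum S P. l \<noteq> 1}"
    using finite_kernel_spectrum[OF finite_S, of P] by (intro Max_in) auto
  then have l: "lambda1 S P \<in> kernel_spectrum S P" "lambda1 S P \<noteq> 1"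
    using False by (auto simp: lambda1_def)
  show ?thesis
  proof (cases "lambda1 S P = 0")
    case True
    then show ?thesis using D.lambda1_P_nonneg by simp
  next
    case False
    then show ?thesis using le_lambda1[OF finite_T] spectrum_P_imp_Q l by blast
  qed
qed

lemma lambda1_eq: "lambda1 S P = lambda1 T Q"
  using lambda1_P_le dual_kernels.lambda1_P_le[OF swap] by (rule antisym)

lemma chi_sq_Q_eq:
  assumes g: "g \<in> T"
  shows "chi_sq T Q \<rho> g (Suc m)
    = (\<Sum>x\<in>S. \<Sum>y\<in>S. B g x * B g y * P.rel_density (Suc (2 * m)) x y)"
proof -
  \<comment> \<open>Balance converts the final half-step back to \<open>g\<close> into a second
    starting weight \<open>B g y\<close>, with density taken relative to
    \<open>\<pi>\<close>.\<close>
  have A: "A y g / \<rho> g = B g y / \<pi> y" if "y \<in> S" for y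
    using balance[OF that g] pi_pos[OF that] rho_pos[OF g] by (simp add: field_simps)
  \<comment> \<open>The weights have total mass 1, so the subtracted 1 can be distributed over the
    double sum.\<close>
  have BB: "(\<Sum>x\<in>S. \<Sum>y\<in>S. B g x * B g y) = 1"
    using B_sum[OF g] by (simp flip: sum_product)
  have "chi_sq T Q \<rho> g (Suc m) = kernel_power T Q (Suc (Suc (2 * m))) g g / \<rho> g - 1"
    using D.P.chi_sq_eq_return[OF g, of "Suc m"]
    by (simp add: D.P.rel_density_def mult_2 del: kernel_power.simps)
  also have "\<dots> = (\<Sum>x\<in>S. \<Sum>y\<in>S. B g x * kernel_power S P (Suc (2 * m)) x y * (A y g / \<rho> g)) - 1"
    by (subst kernel_power_Q_Suc[OF g g]) (simp add: sum_divide_distrib)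
  also have "\<dots> = (\<Sum>x\<in>S. \<Sum>y\<in>S. B g x * kernel_power S P (Suc (2 * m)) x y * (B g y / \<pi> y))
      - (\<Sum>x\<in>S. \<Sum>y\<in>S. B g x * B g y)"
    using A BB by simp
  also have "\<dots> = (\<Sum>x\<in>S. \<Sum>y\<in>S. B g x * B g y * P.rel_density (Suc (2 * m)) x y)"
    unfolding P.rel_density_def sum_subtractf[symmetric]
    by (intro sum.cong refl) (simp add: algebra_simps del: kernel_power.simps)
  finally show ?thesis .
qed

lemma chi_sq_Q_le:
  assumes g: "g \<in> T" and P_pos: "\<And>x y. x \<in> S \<Longrightarrow> y \<in> S \<Longrightarrow> P x y > 0"
  shows "chi_sq T Q \<rho> g (Suc m) \<le> lambda1 S P * (\<Sum>x\<in>S. B g x * chi_sq S P \<pi> x m)"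
proof -
  \<comment> \<open>The centred density after \<open>m\<close> steps of \<open>P\<close> started
    from the law \<open>B g\<close>.\<close>
  define f where "f u = (\<Sum>x\<in>S. B g x * P.rel_density m x u)" for u
  have mean: "(\<Sum>u\<in>S. \<pi> u * f u) = 0"
  proof -
    have "(\<Sum>u\<in>S. \<pi> u * f u) = (\<Sum>x\<in>S. B g x * (\<Sum>u\<in>S. \<pi> u * P.rel_density m x u))"
      unfolding f_def sum_distrib_left by (subst sum.swap) (simp add: mult_ac)
    then show ?thesis by (simp add: P.rel_density_mean)
  qed
  have step: "(\<Sum>v\<in>S. P u v * f v) = (\<Sum>y\<in>S. B g y * P.rel_density (Suc m) y u)" if "u \<in> S" for u
  proof -
    have "(\<Sum>v\<in>S. P u v * f v) = (\<Sum>y\<in>S. B g y * (\<Sum>v\<in>S. P u v * P.rel_density m y v))"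
      unfolding f_def sum_distrib_left by (subst sum.swap) (simp add: mult_ac)
    then show ?thesis using that by (simp add: P.rel_density_step)
  qed
  \<comment> \<open>Pairing \<open>f\<close> with \<open>P f\<close> joins a density at time
    \<open>m\<close> to one at time \<open>m + 1\<close>, which produces the odd time
    \<open>2 * m + 1\<close>.\<close>
  have "P.energy f f = (\<Sum>u\<in>S. \<Sum>x\<in>S. \<Sum>y\<in>S.
      B g x * B g y * (\<pi> u * P.rel_density m x u * P.rel_density (Suc m) y u))"
    unfolding P.energy_eq
    by (intro sum.cong refl)
       (simp add: step, simp add: f_def sum_product sum_distrib_left mult_ac)
  also have "\<dots> = (\<Sum>x\<in>S. \<Sum>y\<in>S. \<Sum>u\<in>S.
      B g x * B g y * (\<pi> u * P.rel_density m x u * P.rel_density (Suc m) y u))"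
    by (subst sum.swap, rule sum.cong[OF refl], rule sum.swap)
  also have "\<dots> = (\<Sum>x\<in>S. \<Sum>y\<in>S. B g x * B g y * P.rel_density (Suc (2 * m)) x y)"
    by (simp add: P.rel_density_inner mult_2 flip: sum_distrib_left)
  finally have "chi_sq T Q \<rho> g (Suc m) = P.energy f f"
    using chi_sq_Q_eq[OF g] by simp
  also have "\<dots> \<le> lambda1 S P * (\<Sum>u\<in>S. \<pi> u * (f u)\<^sup>2)"
    using P.energy_le_lambda1[OF P_pos mean] .
  also have "\<dots> \<le> lambda1 S P * (\<Sum>x\<in>S. B g x * chi_sq S P \<pi> x m)"
  proof (rule mult_left_mono[OF _ lambda1_P_nonneg])
    \<comment> \<open>Jensen's inequality at each \<open>u\<close>, for the probability weights
      \<open>B g\<close>.\<close>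
    have "(\<Sum>u\<in>S. \<pi> u * (f u)\<^sup>2) \<le> (\<Sum>u\<in>S. \<pi> u * (\<Sum>x\<in>S. B g x * (P.rel_density m x u)\<^sup>2))"
      unfolding f_def using g
      by (intro sum_mono mult_left_mono weighted_power2_mean_le)
         (auto simp: B_nonneg B_sum pi_pos less_imp_le)
    also have "\<dots> = (\<Sum>x\<in>S. B g x * chi_sq S P \<pi> x m)"
      unfolding P.chi_sq_eq_rel_density sum_distrib_left
      by (subst sum.swap) (simp add: mult_ac)
    finally show "(\<Sum>u\<in>S. \<pi> u * (f u)\<^sup>2) \<le> (\<Sum>x\<in>S. B g x * chi_sq S P \<pi> x m)" .
  qed
  finally show ?thesis .
qed

end

section \<open>The Burnside kernels\<close>

context group_action
begin

lemma action_one: "x \<in> E \<Longrightarrow> \<phi> \<one> x = x"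
  using id_eq_one by (metis restrict_apply')

lemma one_in_stabilizer: "x \<in> E \<Longrightarrow> \<one> \<in> stabilizer G \<phi> x"
  using action_one group_hom by (simp add: stabilizer_def group_hom_def group.is_monoid)

text \<open>An element fixing \<open>x\<close> has a fixed point and so lies in
  \<open>G_star\<close>; sums over stabilizers become sums over \<open>G_star\<close>.\<close>

lemma stabilizer_eq: "x \<in> E \<Longrightarrow> stabilizer G \<phi> x = {h \<in> G_star G E \<phi>. \<phi> h x = x}"
  by (auto simp: stabilizer_def G_star_def invariants_def)

lemma finite_G_star: "finite (carrier G) \<Longrightarrow> finite (G_star G E \<phi>)"
  by (simp add: G_star_def)

lemma card_invariants_pos: "finite E \<Longrightarrow> h \<in> G_star G E \<phi> \<Longrightarrow> card (invariants E \<phi> h) > 0"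
  by (auto simp: G_star_def card_gt_0_iff invariants_def)

lemma card_stabilizer_pos:
  "finite (carrier G) \<Longrightarrow> x \<in> E \<Longrightarrow> card (stabilizer G \<phi> x) > 0"
  using one_in_stabilizer by (auto simp: card_gt_0_iff stabilizer_def)

text \<open>Double counting of the pairs with \<open>\<phi> h x = x\<close>, followed by Burnside's
  lemma. It gives \<open>burnside_pi_K\<close> total mass 1.\<close>

lemma sum_card_stabilizer:
  assumes "finite (carrier G)" "finite E"
  shows "(\<Sum>x\<in>E. card (stabilizer G \<phi> x)) = Coset.order G * card (orbits G E \<phi>)"
proof -
  have "(\<Sum>x\<in>E. card (stabilizer G \<phi> x)) = (\<Sum>x\<in>E. \<Sum>h\<in>carrier G. if \<phi> h x = x then 1 else 0)"
    using assms by (simp add: stabilizer_def card_as_sums)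
  also have "\<dots> = (\<Sum>h\<in>carrier G. card (invariants E \<phi> h))"
    using assms by (subst sum.swap) (simp add: invariants_def card_as_sums)
  finally show ?thesis using burnside[OF assms] by (simp add: mult.commute)
qed

lemma burnside_normalizer_pos:
  assumes "finite (carrier G)" "finite E" "E \<noteq> {}"
  shows "real (Coset.order G) * real (card (orbits G E \<phi>)) > 0"
proof -
  have "(\<Sum>x\<in>E. card (stabilizer G \<phi> x)) > 0"
    using assms card_stabilizer_pos by (intro sum_pos) auto
  then show ?thesis using sum_card_stabilizer[OF assms(1,2)] by (simp flip: of_nat_mult)
qed

lemma burnside_dual_kernels:
  assumes fin: "finite (carrier G)" "finite E" and ne: "E \<noteq> {}"
  shows "dual_kernels E (G_star G E \<phi>)
    (\<lambda>x h. if \<phi> h x = x then 1 / real (card (stabilizer G \<phi> x)) else 0)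
    (\<lambda>h x. if \<phi> h x = x then 1 / real (card (invariants E \<phi> h)) else 0)
    (burnside_K G E \<phi>) (burnside_Q G E \<phi>) (burnside_pi_K G E \<phi>) (burnside_pi_Q G E \<phi>)"
proof
  note z = burnside_normalizer_pos[OF assms]
  note finT = finite_G_star[OF fin(1)]
  show "finite E" "finite (G_star G E \<phi>)" using fin finT by auto
  show "burnside_pi_K G E \<phi> x > 0" if "x \<in> E" for x
    using z card_stabilizer_pos[OF fin(1) that] by (simp add: burnside_pi_K_def)
  show "burnside_pi_Q G E \<phi> h > 0" if "h \<in> G_star G E \<phi>" for h
    using z card_invariants_pos[OF fin(2) that] by (simp add: burnside_pi_Q_def)
  show "(\<Sum>h\<in>G_star G E \<phi>. if \<phi> h x = x then 1 / real (card (stabilizer G \<phi> x)) else 0) = 1"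
    if "x \<in> E" for x
    using card_stabilizer_pos[OF fin(1) that] finT
    by (auto simp: card_gt_0_iff stabilizer_eq[OF that] simp flip: sum.inter_filter)
  show "(\<Sum>x\<in>E. if \<phi> h x = x then 1 / real (card (invariants E \<phi> h)) else 0) = 1"
    if "h \<in> G_star G E \<phi>" for h
    using card_invariants_pos[OF fin(2) that] fin
    by (auto simp: card_gt_0_iff invariants_def simp flip: sum.inter_filter)
  \<comment> \<open>On fixed pairs both sides are the reciprocal of the common normalizer, elsewhere
    both are 0.\<close>
  show "burnside_pi_K G E \<phi> x * (if \<phi> h x = x then 1 / real (card (stabilizer G \<phi> x)) else 0)
      = burnside_pi_Q G E \<phi> h * (if \<phi> h x = x then 1 / real (card (invariants E \<phi> h)) else 0)"
    if "x \<in> E" "h \<in> G_star G E \<phi>" for x h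
    using card_stabilizer_pos[OF fin(1) that(1)] card_invariants_pos[OF fin(2) that(2)]
    by (simp add: burnside_pi_K_def burnside_pi_Q_def)
  show "(\<Sum>x\<in>E. burnside_pi_K G E \<phi> x) = 1"
    using z sum_card_stabilizer[OF fin]
    by (simp add: burnside_pi_K_def flip: sum_divide_distrib of_nat_sum of_nat_mult)
  show "burnside_K G E \<phi> x y = (\<Sum>h\<in>G_star G E \<phi>.
      (if \<phi> h x = x then 1 / real (card (stabilizer G \<phi> x)) else 0) *
      (if \<phi> h y = y then 1 / real (card (invariants E \<phi> h)) else 0))"
    if "x \<in> E" "y \<in> E" for x y
  proof -
    have "stabilizer G \<phi> x \<inter> stabilizer G \<phi> y = {h \<in> G_star G E \<phi>. \<phi> h x = x \<and> \<phi> h y = y}"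
      using that by (auto simp: stabilizer_eq)
    then show ?thesis
      unfolding burnside_K_def sum_distrib_left using finT
      by (simp only: sum.inter_filter) (auto intro!: sum.cong)
  qed
  show "burnside_Q G E \<phi> h k = (\<Sum>x\<in>E.
      (if \<phi> h x = x then 1 / real (card (invariants E \<phi> h)) else 0) *
      (if \<phi> k x = x then 1 / real (card (stabilizer G \<phi> x)) else 0))" for h k
  proof -
    have "invariants E \<phi> h \<inter> invariants E \<phi> k = {x \<in> E. \<phi> h x = x \<and> \<phi> k x = x}"
      by (auto simp: invariants_def)
    then show ?thesis
      unfolding burnside_Q_def sum_distrib_left using fin
      by (simp only: sum.inter_filter) (auto intro!: sum.cong)
  qed
qed simp

text \<open>The identity lies in every stabilizer and contributes a positive term.\<close>

lemma burnside_K_pos: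
  assumes fin: "finite (carrier G)" "finite E" and xy: "x \<in> E" "y \<in> E"
  shows "burnside_K G E \<phi> x y > 0"
proof -
  have "(\<Sum>h \<in> stabilizer G \<phi> x \<inter> stabilizer G \<phi> y. 1 / real (card (invariants E \<phi> h))) > 0"
    using xy fin one_in_stabilizer
    by (intro sum_pos) (auto simp: stabilizer_eq card_invariants_pos finite_G_star)
  then show ?thesis using card_stabilizer_pos[OF fin(1) xy(1)] by (simp add: burnside_K_def)
qed

end

theorem theorem3p19:
  fixes G :: "('g, 'b) monoid_scheme" and X :: "'x set" and \<phi> :: "'g \<Rightarrow> 'x \<Rightarrow> 'x"
    and g :: 'g and t :: nat
  defines "K \<equiv> burnside_K G X \<phi>" and "\<pi>K \<equiv> burnside_pi_K G X \<phi>"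
    and "Q \<equiv> burnside_Q G X \<phi>" and "\<pi>Q \<equiv> burnside_pi_Q G X \<phi>"
    and "Gstar \<equiv> G_star G X \<phi>" and "Xg \<equiv> invariants X \<phi> g"
  assumes "group_action G X \<phi>" and "finite (carrier G)" and "finite X" and "X \<noteq> {}"
    and "g \<in> Gstar" and "t \<ge> 1"
  shows "lambda1 X K = lambda1 Gstar Q
    \<and> chi_sq Gstar Q \<pi>Q g t =
        (\<Sum>x\<in>Xg. \<Sum>y\<in>Xg. 1 / (real (card Xg))\<^sup>2 *
           (kernel_power X K (2 * t - 1) x y / \<pi>K y - 1))
    \<and> chi_sq Gstar Q \<pi>Q g t
        \<le> lambda1 X K * (1 / real (card Xg)) * (\<Sum>x\<in>Xg. chi_sq X K \<pi>K x (t - 1))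
    \<and> lambda1 X K * (1 / real (card Xg)) * (\<Sum>x\<in>Xg. chi_sq X K \<pi>K x (t - 1))
        \<le> lambda1 X K * Max ((\<lambda>x. chi_sq X K \<pi>K x (t - 1)) ` Xg)"
proof -
  note fin = \<open>finite (carrier G)\<close> \<open>finite X\<close>
  interpret group_action G X \<phi> by fact
  define B where "B h x = (if \<phi> h x = x then 1 / real (card (invariants X \<phi> h)) else 0)" for h x
  interpret dual_kernels X Gstar
    "\<lambda>x h. if \<phi> h x = x then 1 / real (card (stabilizer G \<phi> x)) else 0" B K Q \<pi>K \<pi>Q
    unfolding assms(1-5) B_def by (rule burnside_dual_kernels[OF fin \<open>X \<noteq> {}\<close>])
  have K_pos: "K x y > 0" if "x \<in> X" "y \<in> X" for x y
    unfolding K_def using burnside_K_pos[OF fin that] .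
  \<comment> \<open>\<open>B g\<close> is the uniform law on \<open>Xg\<close>. Applied in both
    variables, this yields the factor \<open>1 / (real (card Xg))\<^sup>2\<close> of the
    identity.\<close>
  have B_mean: "(\<Sum>x\<in>X. B g x * f x) = 1 / real (card Xg) * (\<Sum>x\<in>Xg. f x)" for f :: "'x \<Rightarrow> real"
  proof -
    have "(\<Sum>x\<in>X. B g x * f x) = (\<Sum>x\<in>X. if \<phi> g x = x then 1 / real (card Xg) * f x else 0)"
      by (intro sum.cong) (auto simp: B_def Xg_def)
    also have "\<dots> = (\<Sum>x\<in>Xg. 1 / real (card Xg) * f x)"
      using fin(2) by (simp add: Xg_def invariants_def flip: sum.inter_filter)
    finally show ?thesis by (simp add: sum_distrib_left)
  qed
  have Xg: "finite Xg" "card Xg > 0"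
    using card_invariants_pos[OF fin(2), of g] \<open>g \<in> Gstar\<close> by (auto simp: Xg_def Gstar_def card_gt_0_iff)
  \<comment> \<open>Now \<open>2 * t - 1\<close> is \<open>Suc (2 * m)\<close> and
    \<open>t - 1\<close> is \<open>m\<close>, so the truncated subtractions are exact.\<close>
  obtain m where t: "t = Suc m" using \<open>t \<ge> 1\<close> by (cases t) auto
  have eq: "chi_sq Gstar Q \<pi>Q g t =
      (\<Sum>x\<in>Xg. \<Sum>y\<in>Xg. 1 / (real (card Xg))\<^sup>2 * (kernel_power X K (2 * t - 1) x y / \<pi>K y - 1))"
  proof -
    have "chi_sq Gstar Q \<pi>Q g t
        = (\<Sum>x\<in>X. B g x * (\<Sum>y\<in>X. B g y * P.rel_density (Suc (2 * m)) x y))"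
      unfolding t chi_sq_Q_eq[OF \<open>g \<in> Gstar\<close>] by (simp add: sum_distrib_left mult.assoc)
    also have "\<dots> = (\<Sum>x\<in>Xg. \<Sum>y\<in>Xg. 1 / (real (card Xg))\<^sup>2 * P.rel_density (Suc (2 * m)) x y)"
      unfolding B_mean by (simp add: sum_distrib_left power2_eq_square)
    finally show ?thesis by (simp add: P.rel_density_def t del: kernel_power.simps)
  qed
  have le: "chi_sq Gstar Q \<pi>Q g t
      \<le> lambda1 X K * (1 / real (card Xg)) * (\<Sum>x\<in>Xg. chi_sq X K \<pi>K x (t - 1))"
    using chi_sq_Q_le[OF \<open>g \<in> Gstar\<close> K_pos, of m] unfolding B_mean by (simp add: t)
  have "(\<Sum>x\<in>Xg. chi_sq X K \<pi>K x (t - 1))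
      \<le> real (card Xg) * Max ((\<lambda>x. chi_sq X K \<pi>K x (t - 1)) ` Xg)"
    using Xg by (intro sum_bounded_above) auto
  then have "1 / real (card Xg) * (\<Sum>x\<in>Xg. chi_sq X K \<pi>K x (t - 1))
      \<le> Max ((\<lambda>x. chi_sq X K \<pi>K x (t - 1)) ` Xg)"
    using Xg(2) by (simp add: field_simps)
  \<comment> \<open>Passing from the average to the maximum under the factor
    \<open>lambda1 X K\<close> relies on its being nonnegative.\<close>
  then have "lambda1 X K * (1 / real (card Xg)) * (\<Sum>x\<in>Xg. chi_sq X K \<pi>K x (t - 1))
      \<le> lambda1 X K * Max ((\<lambda>x. chi_sq X K \<pi>K x (t - 1)) ` Xg)"
    unfolding mult.assoc by (rule mult_left_mono[OF _ lambda1_P_nonneg])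
  then show ?thesis using lambda1_eq eq le by blast
qed

end
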